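(* Let $(\mathcal{R},\leq,r)$ be a topological Ramsey space and $\mathcal{H}\subseteq\mathcal{R}$ a selective coideal. Then a set $\mathcal{X}\subseteq\mathcal{R}$ is $\mathcal{H}$-Ramsey if and only if $\mathcal{X}$ is $\mathcal{H}$-Baire.
   Context: A triple $(\mathcal{R},\leq,r)$ consists of a set $\mathcal{R}$, a quasi order $\leq$ on $\mathcal{R}$ and a function $r:\mathbb{N}\times\mathcal{R}\to\mathcal{AR}$ with range $\mathcal{AR}$; write $r_n(A)=r(n,A)$ and $\mathcal{AR}_n=\{r_n(A):A\in\mathcal{R}\}$. Assume: (A.1) $r_0(A)=\emptyset$ for all $A$; (A.2) if $A\neq B$ then $r_n(A)\neq r_n(B)$ for some $n$; (A.3) if $r_n(A)=r_m(B)$ then $n=m$ and $r_i(A)=r_i(B)$ for all $i<n$. For $a\in\mathcal{AR}$, $|a|$ is the unique $n$ with $a=r_n(A)$ for some $A$. For $a\in\mathcal{AR}$, $A\in\mathcal{R}$ let $[a,A]=\{B\in\mathcal{R}:\exists n\,(r_n(B)=a)\text{ and }B\leq A\}$; $a$ is compatible with $A$ if $[a,A]\neq\emptyset$; $\mathcal{AR}(A)$ is the set of $a$ compatible with $A$; $[n,A]=[r_n(A),A]$; $r_{k}([a,B])=\{r_k(C):C\in[a,B]\}$. Identifying $A$ with $(r_n(A))_n$, $\mathcal{R}$ is a subspace of $\mathcal{AR}^{\mathbb{N}}$ ($\mathcal{AR}$ discrete, product topology); $\mathcal{R}$ is metrically closed if it is closed there. (A.4) There is a quasi order $\leq_{fin}$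 on $\mathcal{AR}$ with: $A\leq B$ iff $\forall n\exists m\ r_n(A)\leq_{fin}r_m(B)$; and $\{b:b\leq_{fin}a\}$ is finite for each $a$. $depth_A(a)$ is the least $n$ with $a\leq_{fin}r_n(A)$. (A.5) For compatible $a,A$ with $depth_A(a)=n$: (i) $[a,B]\neq\emptyset$ for all $B\in[n,A]$; (ii) for all $B\in[a,A]$ there is $A'\in[n,A]$ with $[a,A']\subseteq[a,B]$. (A.6) For compatible $a,A$ with $depth_A(a)=n$ and any $\phi:\mathcal{AR}_{|a|+1}\to\{0,1\}$ there is $B\in[n,A]$ with $\phi$ constant on $r_{|a|+1}([a,B])$. A topological Ramsey space is such a triple satisfying (A.1)–(A.6) with $\mathcal{R}$ metrically closed. For $\mathcal{H}\subseteq\mathcal{R}$ and $A\in\mathcal{R}$, $\mathcal{H}\!\upharpoonright\! A=\{B\in\mathcal{H}:B\leq A\}$. $\mathcal{H}$ is a coideal if: (1) $A\leq B$, $A\in\mathcal{H}$ imply $B\in\mathcal{H}$; (2) for $A\in\mathcal{H}$, $a\in\mathcal{AR}(A)$, $n=depth_A(a)$: (i) for all $B\in[n,A]\cap\mathcal{H}$, $[a,B]\cap\mathcal{H}\neq\emptyset$; (ii) for all $B\in[a,A]\cap\mathcal{H}$ there is $A'\in[n,A]\cap\mathcal{H}$ with $[a,A']\subseteq[a,B]$; (3) for $a\in\mathcal{AR}$ of length $l$, $\mathcal{O}\subseteq\mathcal{AR}_{l+1}$ and every $A\in\mathcal{H}$ with $[a,A]\neq\emptyset$ there is $B\in[depth_A(a),A]\cap\mathcal{H}$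 with $r_{l+1}([a,B])\subseteq\mathcal{O}$ or $r_{l+1}([a,B])\subseteq\mathcal{AR}_{l+1}\setminus\mathcal{O}$. A coideal $\mathcal{H}$ is selective if for every $A\in\mathcal{H}$, $\mathcal{I}\subseteq\mathcal{AR}$ and family $(A_a)_{a\in\mathcal{I}}$ with $A_a\in\mathcal{H}\!\upharpoonright\! A$ and $[a,A_a]\neq\emptyset$, there is $B\in\mathcal{H}\!\upharpoonright\! A$ with $[a,B]\subseteq[a,A_a]$ for all $a\in\mathcal{I}\cap\mathcal{AR}(B)$. $\mathcal{X}\subseteq\mathcal{R}$ is $\mathcal{H}$-Ramsey if for every $[a,A]\neq\emptyset$ with $A\in\mathcal{H}$ there exists $B\in[a,A]\cap\mathcal{H}$ with $[a,B]\neq\emptyset$ such that $[a,B]\subseteq\mathcal{X}$ or $[a,B]\subseteq\mathcal{R}\setminus\mathcal{X}$. $\mathcal{X}$ is $\mathcal{H}$-Baire if for every $[a,A]\neq\emptyset$ with $A\in\mathcal{H}$ there exist $b\in\mathcal{AR}$ and $B\in\mathcal{H}$ with $\emptyset\neq[b,B]\subseteq[a,A]$ such that $[b,B]\subseteq\mathcal{X}$ or $[b,B]\subseteq\mathcal{R}\setminus\mathcal{X}$. *)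

theory Defs
  imports "HOL-Analysis.Analysis"
begin

text \<open>
  The points of the space are the elements of the set \<open>R\<close>; \<open>emp\<close> is the
  approximation of length 0 (the empty set). Axiom (A.4) asserts that a quasi order
  \<open>\<le>\<^sub>f\<^sub>i\<^sub>n\<close> exists, but depth and hence coideals are defined from it, so it is part of
  the data.
\<close>

locale approx_structure =
  fixes R :: "'r set"
    and le :: "'r \<Rightarrow> 'r \<Rightarrow> bool" (infix "\<sqsubseteq>" 50)
    and r :: "nat \<Rightarrow> 'r \<Rightarrow> 'a"
    and emp :: 'a
    and lefin :: "'a \<Rightarrow> 'a \<Rightarrow> bool" (infix "\<sqsubseteq>\<^sub>f\<^sub>i\<^sub>n" 50)
begin

definition ARn :: "nat \<Rightarrow> 'a set" where
  "ARn n = {r n A | A. A \<in> R}"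

definition AR :: "'a set" where
  "AR = {r n A | n A. A \<in> R}"

definition len :: "'a \<Rightarrow> nat" where
  "len a = (THE n. \<exists>A\<in>R. a = r n A)"

definition nbhd :: "'a \<Rightarrow> 'r \<Rightarrow> 'r set" where
  "nbhd a A = {B \<in> R. (\<exists>n. r n B = a) \<and> B \<sqsubseteq> A}"

definition nbhd_at :: "nat \<Rightarrow> 'r \<Rightarrow> 'r set" where
  "nbhd_at n A = nbhd (r n A) A"

definition AR_below :: "'r \<Rightarrow> 'a set" where
  "AR_below A = {a \<in> AR. nbhd a A \<noteq> {}}"

text \<open>Only meaningful if \<open>a\<close> is below some \<open>r n A\<close>, e.g. if \<open>a\<close> is compatible with \<open>A\<close>.\<close>

definition depth :: "'r \<Rightarrow> 'a \<Rightarrow> nat" where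
  "depth A a = (LEAST n. a \<sqsubseteq>\<^sub>f\<^sub>i\<^sub>n r n A)"

definition metrically_closed :: bool where
  "metrically_closed \<longleftrightarrow>
     closedin (product_topology (\<lambda>_::nat. discrete_topology AR) UNIV) ((\<lambda>A n. r n A) ` R)"

definition restr :: "'r set \<Rightarrow> 'r \<Rightarrow> 'r set" where
  "restr H A = {B \<in> H. B \<sqsubseteq> A}"

definition coideal :: "'r set \<Rightarrow> bool" where
  "coideal H \<longleftrightarrow>
     H \<subseteq> R \<and>
     (\<forall>A\<in>R. \<forall>B\<in>R. A \<sqsubseteq> B \<longrightarrow> A \<in> H \<longrightarrow> B \<in> H) \<and>
     (\<forall>A\<in>H. \<forall>a\<in>AR_below A.
        (\<forall>B \<in> nbhd_at (depth A a) A \<inter> H. nbhd a B \<inter> H \<noteq> {}) \<and>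
        (\<forall>B \<in> nbhd a A \<inter> H. \<exists>A' \<in> nbhd_at (depth A a) A \<inter> H. nbhd a A' \<subseteq> nbhd a B)) \<and>
     (\<forall>a\<in>AR. \<forall>S \<subseteq> ARn (len a + 1). \<forall>A\<in>H. nbhd a A \<noteq> {} \<longrightarrow>
        (\<exists>B \<in> nbhd_at (depth A a) A \<inter> H.
           r (len a + 1) ` nbhd a B \<subseteq> S \<or>
           r (len a + 1) ` nbhd a B \<subseteq> ARn (len a + 1) - S))"

definition selective :: "'r set \<Rightarrow> bool" where
  "selective H \<longleftrightarrow>
     (\<forall>A\<in>H. \<forall>I \<subseteq> AR. \<forall>F :: 'a \<Rightarrow> 'r.
        (\<forall>a\<in>I. F a \<in> restr H A \<and> nbhd a (F a) \<noteq> {}) \<longrightarrow>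
        (\<exists>B \<in> restr H A. \<forall>a \<in> I \<inter> AR_below B. nbhd a B \<subseteq> nbhd a (F a)))"

definition Ramsey_for :: "'r set \<Rightarrow> 'r set \<Rightarrow> bool" where
  "Ramsey_for H X \<longleftrightarrow>
     (\<forall>a\<in>AR. \<forall>A\<in>H. nbhd a A \<noteq> {} \<longrightarrow>
        (\<exists>B \<in> nbhd a A \<inter> H. nbhd a B \<noteq> {} \<and> (nbhd a B \<subseteq> X \<or> nbhd a B \<subseteq> R - X)))"

definition Baire_for :: "'r set \<Rightarrow> 'r set \<Rightarrow> bool" where
  "Baire_for H X \<longleftrightarrow>
     (\<forall>a\<in>AR. \<forall>A\<in>H. nbhd a A \<noteq> {} \<longrightarrow>
        (\<exists>b\<in>AR. \<exists>B\<in>H. nbhd b B \<noteq> {} \<and> nbhd b B \<subseteq> nbhd a A \<and>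
           (nbhd b B \<subseteq> X \<or> nbhd b B \<subseteq> R - X)))"

end

locale topological_Ramsey_space = approx_structure R le r emp lefin
  for R :: "'r set"
    and le :: "'r \<Rightarrow> 'r \<Rightarrow> bool" (infix "\<sqsubseteq>" 50)
    and r :: "nat \<Rightarrow> 'r \<Rightarrow> 'a"
    and emp :: 'a
    and lefin :: "'a \<Rightarrow> 'a \<Rightarrow> bool" (infix "\<sqsubseteq>\<^sub>f\<^sub>i\<^sub>n" 50) +
  assumes le_refl: "reflp_on R (\<sqsubseteq>)"
    and le_trans: "transp_on R (\<sqsubseteq>)"
    and A1: "\<And>A. A \<in> R \<Longrightarrow> r 0 A = emp"
    and A2: "\<And>A B. A \<in> R \<Longrightarrow> B \<in> R \<Longrightarrow> A \<noteq> B \<Longrightarrow> \<exists>n. r n A \<noteq> r n B"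
    and A3: "\<And>A B n m. A \<in> R \<Longrightarrow> B \<in> R \<Longrightarrow> r n A = r m B \<Longrightarrow>
               n = m \<and> (\<forall>i<n. r i A = r i B)"
    and A4_refl: "reflp_on AR (\<sqsubseteq>\<^sub>f\<^sub>i\<^sub>n)"
    and A4_trans: "transp_on AR (\<sqsubseteq>\<^sub>f\<^sub>i\<^sub>n)"
    and A4_le: "\<And>A B. A \<in> R \<Longrightarrow> B \<in> R \<Longrightarrow>
                  A \<sqsubseteq> B \<longleftrightarrow> (\<forall>n. \<exists>m. r n A \<sqsubseteq>\<^sub>f\<^sub>i\<^sub>n r m B)"
    and A4_finite: "\<And>a. a \<in> AR \<Longrightarrow> finite {b \<in> AR. b \<sqsubseteq>\<^sub>f\<^sub>i\<^sub>n a}"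
    and A5_i: "\<And>a A B. A \<in> R \<Longrightarrow> a \<in> AR_below A \<Longrightarrow> B \<in> nbhd_at (depth A a) A \<Longrightarrow>
                 nbhd a B \<noteq> {}"
    and A5_ii: "\<And>a A B. A \<in> R \<Longrightarrow> a \<in> AR_below A \<Longrightarrow> B \<in> nbhd a A \<Longrightarrow>
                  \<exists>A' \<in> nbhd_at (depth A a) A. nbhd a A' \<subseteq> nbhd a B"
    and A6: "\<And>a A \<phi>. A \<in> R \<Longrightarrow> a \<in> AR_below A \<Longrightarrow> \<phi> \<in> ARn (len a + 1) \<rightarrow> {0, 1::nat} \<Longrightarrow>
               \<exists>B \<in> nbhd_at (depth A a) A. \<phi> constant_on (r (len a + 1) ` nbhd a B)"
    and closed: "metrically_closed"

end

theory Submission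
  imports Defs
begin

text \<open>
  The difficulty is that selectivity yields some \<open>B \<le> A\<close> in \<open>H\<close> without any control over its initial
  segments, so a given \<open>a\<close> compatible with \<open>A\<close> need not be compatible with \<open>B\<close>. The remedy is to
  use \<open>B\<close> only as a guide: every approximation \<open>b\<close> is assigned some \<open>A\<^sub>b \<in> H\<close> and a level \<open>m\<^sub>b\<close> so that,
  along the initial segments \<open>b\<close> of the diagonalization \<open>B\<close>, the \<open>A\<^sub>b\<close> form a fusion sequence starting
  at \<open>A\<close> with \<open>b\<close> below the part of \<open>A\<^sub>b\<close> already fixed. The limit of the sequence lies above \<open>B\<close>,
  hence belongs to \<open>H\<close>, and it still agrees with \<open>A\<close> up to the depth of \<open>a\<close>.

  With this fusion one first makes every extension of \<open>a\<close> either decided (its neighbourhood is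
  contained in \<open>X\<close> or in the complement) or rejected (no member of \<open>H\<close> below decides it), and then
  makes all one-step extensions of rejected approximations rejected. If \<open>a\<close> itself were rejected, so
  would be all its extensions, which contradicts the Baire property.
\<close>

locale selective_coideal = topological_Ramsey_space R le r emp lefin
  for R :: "'r set"
    and le :: "'r \<Rightarrow> 'r \<Rightarrow> bool" (infix "\<sqsubseteq>" 50)
    and r :: "nat \<Rightarrow> 'r \<Rightarrow> 'a"
    and emp :: 'a
    and lefin :: "'a \<Rightarrow> 'a \<Rightarrow> bool" (infix "\<sqsubseteq>\<^sub>f\<^sub>i\<^sub>n" 50) +
  fixes H :: "'r set"
  assumes coideal: "coideal H"
    and selective: "selective H"
begin

section \<open>Order, approximations and basic neighbourhoods\<close>

lemma le_reflI: "A \<in> R \<Longrightarrow> A \<sqsubseteq> A"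
  using le_refl by (auto simp: reflp_on_def)

lemma le_transD: "A \<sqsubseteq> B \<Longrightarrow> B \<sqsubseteq> C \<Longrightarrow> A \<in> R \<Longrightarrow> B \<in> R \<Longrightarrow> C \<in> R \<Longrightarrow> A \<sqsubseteq> C"
  using transp_onD[OF le_trans] by blast

lemma H_in_R: "A \<in> H \<Longrightarrow> A \<in> R"
  using coideal by (auto simp: coideal_def)

lemma H_upward: "A \<in> H \<Longrightarrow> A \<sqsubseteq> B \<Longrightarrow> B \<in> R \<Longrightarrow> B \<in> H"
  using coideal H_in_R unfolding coideal_def by blast

lemma r_in_AR: "A \<in> R \<Longrightarrow> r n A \<in> AR"
  by (auto simp: AR_def)

lemma r_eq_initial: "A \<in> R \<Longrightarrow> B \<in> R \<Longrightarrow> r m A = r m B \<Longrightarrow> i \<le> m \<Longrightarrow> r i A = r i B"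
  using A3[of A B m m] by (cases "i = m") auto

lemma len_r: assumes "A \<in> R" shows "len (r n A) = n"
  unfolding len_def using assms A3 by (intro the_equality) blast+

lemma nbhd_iff: "C \<in> nbhd a A \<longleftrightarrow> C \<in> R \<and> r (len a) C = a \<and> C \<sqsubseteq> A"
  using len_r by (auto simp: nbhd_def)

lemma nbhd_at_iff: "A \<in> R \<Longrightarrow> C \<in> nbhd_at n A \<longleftrightarrow> C \<in> R \<and> r n C = r n A \<and> C \<sqsubseteq> A"
  by (auto simp: nbhd_at_def nbhd_iff len_r)

lemma nbhd_mono: "B \<sqsubseteq> A \<Longrightarrow> A \<in> R \<Longrightarrow> B \<in> R \<Longrightarrow> nbhd a B \<subseteq> nbhd a A"
  using le_transD by (auto simp: nbhd_iff)

lemma nbhd_at_refl: "A \<in> R \<Longrightarrow> A \<in> nbhd_at n A"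
  by (simp add: nbhd_at_iff le_reflI)

lemma nbhd_at_trans:
  assumes "C \<in> nbhd_at m B" "B \<in> nbhd_at n A" "n \<le> m" "A \<in> R"
  shows "C \<in> nbhd_at n A"
proof -
  have B: "B \<in> R" using assms by (simp add: nbhd_at_iff)
  then show ?thesis using assms r_eq_initial[of C B m n] le_transD[of C B A]
    by (simp add: nbhd_at_iff)
qed

lemma nbhd_at_antimono: "B \<in> nbhd_at m A \<Longrightarrow> n \<le> m \<Longrightarrow> A \<in> R \<Longrightarrow> B \<in> nbhd_at n A"
  using nbhd_at_trans nbhd_at_refl by blast

lemma nbhd_at_r: "B \<in> nbhd_at m A \<Longrightarrow> i \<le> m \<Longrightarrow> A \<in> R \<Longrightarrow> r i B = r i A"
  by (meson nbhd_at_antimono nbhd_at_iff)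

lemma AR_below_iff: "a \<in> AR_below A \<longleftrightarrow> nbhd a A \<noteq> {}"
proof -
  have "a \<in> AR" if "C \<in> nbhd a A" for C using that r_in_AR[of C "len a"] by (auto simp: nbhd_iff)
  then show ?thesis by (auto simp: AR_below_def)
qed

lemma AR_below_mono: "a \<in> AR_below B \<Longrightarrow> B \<sqsubseteq> A \<Longrightarrow> A \<in> R \<Longrightarrow> B \<in> R \<Longrightarrow> a \<in> AR_below A"
  using nbhd_mono by (fastforce simp: AR_below_iff)

lemma AR_below_r: "C \<in> R \<Longrightarrow> C \<sqsubseteq> A \<Longrightarrow> r n C \<in> AR_below A"
  by (auto simp: AR_below_iff nbhd_def)

section \<open>Depth\<close>

lemma lefin_depth:
  assumes "a \<in> AR_below A" "A \<in> R" shows "a \<sqsubseteq>\<^sub>f\<^sub>i\<^sub>n r (depth A a) A"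
proof -
  obtain C where "C \<in> R" "r (len a) C = a" "C \<sqsubseteq> A" using assms by (auto simp: AR_below_iff nbhd_iff)
  then have "\<exists>n. a \<sqsubseteq>\<^sub>f\<^sub>i\<^sub>n r n A" using A4_le[of C A] assms by metis
  then show ?thesis unfolding depth_def by (rule LeastI_ex)
qed

lemma depth_le: "a \<sqsubseteq>\<^sub>f\<^sub>i\<^sub>n r n A \<Longrightarrow> depth A a \<le> n"
  unfolding depth_def by (rule Least_le)

lemma depth_cong:
  assumes "a \<in> AR_below A" "A \<in> R" "depth A a \<le> m" "B \<in> R" "r m B = r m A"
  shows "depth B a = depth A a"
proof -
  have eq: "r i B = r i A" if "i \<le> m" for i using r_eq_initial assms that by metis
  have le: "depth B a \<le> depth A a" using lefin_depth[OF assms(1,2)] eq assms(3) depth_le by metis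
  have "a \<sqsubseteq>\<^sub>f\<^sub>i\<^sub>n r (depth B a) B"
    unfolding depth_def by (rule LeastI[of _ "depth A a"]) (use lefin_depth assms eq in auto)
  then have "depth A a \<le> depth B a" using eq[of "depth B a"] le assms(3) depth_le by simp
  with le show ?thesis by simp
qed

text \<open>(A.5)(i) keeps \<open>a\<close> compatible, and its depth is determined by the part of
  \<open>A\<close> up to level \<open>m\<close>, which \<open>B\<close> shares. Hence an
  approximation of depth at most \<open>m\<close> survives all later changes above that
  level.\<close>

lemma nbhd_at_compatible:
  assumes "a \<in> AR_below A" "A \<in> R" "depth A a \<le> m" "B \<in> nbhd_at m A"
  shows "a \<in> AR_below B" "depth B a = depth A a"
proof -
  have B: "B \<in> R" "r m B = r m A" using assms(2,4) by (auto simp: nbhd_at_iff)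
  show "a \<in> AR_below B"
    using A5_i[OF assms(2,1) nbhd_at_antimono[OF assms(4,3,2)]] by (simp add: AR_below_iff)
  show "depth B a = depth A a" by (rule depth_cong[OF assms(1,2,3) B])
qed

text \<open>The converse transfer: a depth of at most \<open>m\<close> is computed inside the common
  part of \<open>A\<close> and \<open>B\<close>. It traces an approximation found below a later
  stage, or below a limit, back to an earlier stage.\<close>

lemma depth_nbhd_at_eq:
  assumes "B \<in> nbhd_at m A" "A \<in> R" "a \<in> AR_below B" "depth B a \<le> m"
  shows "a \<in> AR_below A" "depth A a = depth B a"
proof -
  have B: "B \<in> R" "r m A = r m B" "B \<sqsubseteq> A" using assms(1,2) by (auto simp: nbhd_at_iff)
  show "a \<in> AR_below A" by (rule AR_below_mono[OF assms(3) B(3) assms(2) B(1)])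
  show "depth A a = depth B a" by (rule depth_cong[OF assms(3) B(1) assms(4,2) B(2)])
qed

lemma finite_below_r:
  assumes "A \<in> R" shows "finite {a \<in> AR_below A. depth A a \<le> m}"
proof (rule finite_subset)
  show "{a \<in> AR_below A. depth A a \<le> m} \<subseteq> (\<Union>i\<le>m. {b \<in> AR. b \<sqsubseteq>\<^sub>f\<^sub>i\<^sub>n r i A})"
    using lefin_depth assms by (auto simp: AR_below_def)
  show "finite (\<Union>i\<le>m. {b \<in> AR. b \<sqsubseteq>\<^sub>f\<^sub>i\<^sub>n r i A})"
    using A4_finite r_in_AR assms by auto
qed

lemma inj_r: "A \<in> R \<Longrightarrow> inj (\<lambda>n. r n A)"
  by (rule injI) (use A3 in blast)

text \<open>By (A.3) the approximations of \<open>C\<close> are pairwise distinct, while (A.4)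
  leaves only finitely many of bounded depth in \<open>A\<close>.\<close>

lemma depth_r_unbounded:
  assumes "C \<in> R" "A \<in> R" "C \<sqsubseteq> A" shows "\<exists>k. n \<le> depth A (r k C)"
proof (rule ccontr)
  assume "\<nexists>k. n \<le> depth A (r k C)"
  then have "range (\<lambda>k. r k C) \<subseteq> {a \<in> AR_below A. depth A a \<le> n}"
    using AR_below_r assms by (auto simp: not_le intro: less_imp_le)
  then show False
    using finite_below_r[OF assms(2)] finite_subset inj_r[OF assms(1)] range_inj_infinite by blast
qed

text \<open>End-extension. Elements of \<open>'a\<close> carry no internal structure, so a point
  \<open>C\<close> has to witness that both are its initial segments.\<close>

definition extends :: "'a \<Rightarrow> 'a \<Rightarrow> bool" where
  "extends a b \<longleftrightarrow> (\<exists>C\<in>R. \<exists>i j. i \<le> j \<and> r i C = a \<and> r j C = b)"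

lemma extends_nbhd: "extends a b \<Longrightarrow> nbhd b A \<subseteq> nbhd a A"
proof
  fix D assume "extends a b" and D: "D \<in> nbhd b A"
  then obtain C i j where C: "C \<in> R" "i \<le> j" "r i C = a" "r j C = b" unfolding extends_def by blast
  have "r j D = b" "D \<in> R" using D C len_r by (auto simp: nbhd_iff)
  then show "D \<in> nbhd a A" using r_eq_initial[of D C j i] C D by (auto simp: nbhd_def)
qed

section \<open>The clauses of a coideal\<close>

lemma coideal_meets:
  assumes "A \<in> H" "a \<in> AR_below A" shows "\<exists>B\<in>H. B \<in> nbhd a A"
proof -
  have "\<forall>A\<in>H. \<forall>a\<in>AR_below A. \<forall>B \<in> nbhd_at (depth A a) A \<inter> H. nbhd a B \<inter> H \<noteq> {}"
    using coideal unfolding coideal_def by simp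
  moreover have "A \<in> nbhd_at (depth A a) A \<inter> H" using assms nbhd_at_refl H_in_R by simp
  ultimately have "nbhd a A \<inter> H \<noteq> {}" using assms by simp
  then show ?thesis by blast
qed

lemma coideal_amalgamate:
  assumes "A \<in> H" "a \<in> AR_below A" "B \<in> H" "B \<in> nbhd a A"
  shows "\<exists>A'\<in>H. A' \<in> nbhd_at (depth A a) A \<and> nbhd a A' \<subseteq> nbhd a B"
proof -
  have "\<forall>A\<in>H. \<forall>a\<in>AR_below A. \<forall>B \<in> nbhd a A \<inter> H.
      \<exists>A' \<in> nbhd_at (depth A a) A \<inter> H. nbhd a A' \<subseteq> nbhd a B"
    using coideal unfolding coideal_def by simp
  then have "\<exists>A' \<in> nbhd_at (depth A a) A \<inter> H. nbhd a A' \<subseteq> nbhd a B" using assms by simp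
  then show ?thesis by blast
qed

lemma coideal_pigeonhole:
  assumes "A \<in> H" "a \<in> AR_below A"
  shows "\<exists>B\<in>H. B \<in> nbhd_at (depth A a) A \<and>
    ((\<forall>C\<in>nbhd a B. P (r (len a + 1) C)) \<or> (\<forall>C\<in>nbhd a B. \<not> P (r (len a + 1) C)))"
proof -
  have "\<exists>B\<in>nbhd_at (depth A a) A \<inter> H.
      r (len a + 1) ` nbhd a B \<subseteq> {c \<in> ARn (len a + 1). P c} \<or>
      r (len a + 1) ` nbhd a B \<subseteq> ARn (len a + 1) - {c \<in> ARn (len a + 1). P c}"
  proof -
    have "\<forall>a\<in>AR. \<forall>S \<subseteq> ARn (len a + 1). \<forall>A\<in>H. nbhd a A \<noteq> {} \<longrightarrow>
        (\<exists>B \<in> nbhd_at (depth A a) A \<inter> H.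
           r (len a + 1) ` nbhd a B \<subseteq> S \<or>
           r (len a + 1) ` nbhd a B \<subseteq> ARn (len a + 1) - S)"
      using coideal unfolding coideal_def by (elim conjE)
    then show ?thesis using assms by (simp add: AR_below_def)
  qed
  then show ?thesis by blast
qed

section \<open>Limits of fusion sequences\<close>

lemma nbhd_at_chain:
  assumes A: "\<And>j. A j \<in> R" and step: "\<And>j. A (Suc j) \<in> nbhd_at (m j) (A j)"
    and mono: "\<And>j. m j \<le> m (Suc j)" and "j \<le> k"
  shows "A k \<in> nbhd_at (m j) (A j)"
  using \<open>j \<le> k\<close>
proof (induction k rule: dec_induct)
  case base
  then show ?case using A nbhd_at_refl by simp
next
  case (step k)
  have "m j \<le> m k" using lift_Suc_mono_le[of m] mono step by simp
  then show ?case using nbhd_at_trans[OF assms(2) step.IH] A by simp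
qed

text \<open>The approximations of the \<open>A j\<close> stabilise, and metric closedness makes the
  sequence of stable values come from a point of \<open>R\<close>. Membership of the limit in
  \<open>H\<close> has to be obtained separately.\<close>

lemma limit_exists:
  assumes A: "\<And>j. A j \<in> R" and step: "\<And>j. A (Suc j) \<in> nbhd_at (m j) (A j)"
    and mono: "\<And>j. m j \<le> m (Suc j)" and unb: "\<And>k. \<exists>j. k \<le> m j"
  shows "\<exists>B\<in>R. \<forall>j. B \<in> nbhd_at (m j) (A j)"
proof -
  note chain = nbhd_at_chain[of A m, OF A step mono]
  \<comment> \<open>\<open>J k\<close> is the first stage whose level reaches \<open>k\<close>.
    Approximations of length up to \<open>k\<close> no longer change from there on, so
    \<open>f\<close> records the stable values.\<close>
  define J where "J k = (LEAST j. k \<le> m j)" for k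
  have J: "k \<le> m (J k)" for k unfolding J_def by (rule LeastI_ex) (rule unb)
  have J_le: "J k \<le> j" if "k \<le> m j" for k j unfolding J_def using that by (rule Least_le)
  define f where "f k = r k (A (J k))" for k
  have f: "r k (A j) = f k" if "k \<le> m j" for k j
    unfolding f_def using nbhd_at_r[OF chain[OF J_le[OF that]] J A] .
  let ?T = "product_topology (\<lambda>_::nat. discrete_topology AR) UNIV"
  have "f \<in> (\<lambda>A n. r n A) ` R"
  proof (rule ccontr)
    assume nf: "f \<notin> (\<lambda>A n. r n A) ` R"
    define W where "W = topspace ?T - (\<lambda>A n. r n A) ` R"
    have oW: "openin ?T W" unfolding W_def
      using closed unfolding metrically_closed_def by (auto simp: closedin_def)
    have "f \<in> W"
      using nf A r_in_AR by (auto simp: f_def W_def)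
    \<comment> \<open>A basic open box around \<open>f\<close> restricts finitely many coordinates,
      and for large \<open>k\<close> the point \<open>A (J k)\<close> agrees with \<open>f\<close>
      on them. Its sequence would then lie in \<open>W\<close>, which is disjoint from the image of
      \<open>R\<close>.\<close>
    then obtain U where U: "finite {i. U i \<noteq> AR}" "f \<in> Pi\<^sub>E UNIV U" "Pi\<^sub>E UNIV U \<subseteq> W"
      using openin_product_topology_alt[THEN iffD1, OF oW] by force
    obtain k where k: "\<And>i. U i \<noteq> AR \<Longrightarrow> i \<le> k"
      using U(1) finite_nat_set_iff_bounded_le by auto
    have "(\<lambda>n. r n (A (J k))) \<in> Pi\<^sub>E UNIV U"
    proof -
      have "r i (A (J k)) \<in> U i" for i
      proof (cases "U i = AR")
        case True then show ?thesis using A r_in_AR by simp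
      next
        case False
        then have "r i (A (J k)) = f i" using f[of i "J k"] k[of i] J[of k] by simp
        then show ?thesis using U(2) by auto
      qed
      then show ?thesis by auto
    qed
    then have "(\<lambda>n. r n (A (J k))) \<in> W" using U(3) by blast
    then show False using A by (simp add: W_def)
  qed
  then obtain B where B: "B \<in> R" "\<And>n. f n = r n B" by (auto simp: fun_eq_iff)
  have "B \<in> nbhd_at (m j) (A j)" for j
  proof -
    have "\<exists>m'. r n B \<sqsubseteq>\<^sub>f\<^sub>i\<^sub>n r m' (A j)" for n
    proof -
      define i where "i = max j (J n)"
      have "m (J n) \<le> m i" using lift_Suc_mono_le[of m] mono i_def by simp
      then have "r n B = r n (A i)" using f[of n i] B(2)[of n] J[of n] by simp
      moreover have "A i \<sqsubseteq> A j" using chain[of j i] A by (simp add: i_def nbhd_at_iff)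
      ultimately show ?thesis using A4_le[OF A A, of i j] by simp
    qed
    then show ?thesis using A4_le[OF B(1) A, of j] B f[of "m j" j] A by (simp add: nbhd_at_iff)
  qed
  then show ?thesis using B by blast
qed

section \<open>Amalgamation and pigeonhole at a prescribed level\<close>

text \<open>
  Clause (2)(ii) of a coideal, with an arbitrary level \<open>m\<close> in place of the depth of \<open>b\<close>. The axioms do
  not make the depth monotone under end-extension; if \<open>c\<close> extends \<open>b\<close> by one step but has depth at
  most \<open>m\<close>, then \<open>c\<close> can be made the only extension of \<open>b\<close>, and so inherits the property.
\<close>

definition amalg :: "'a \<Rightarrow> nat \<Rightarrow> 'r \<Rightarrow> bool" where
  "amalg b m A \<longleftrightarrow> A \<in> H \<and> b \<in> AR_below A \<and> depth A b \<le> m \<and>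
     (\<forall>A1\<in>H. A1 \<in> nbhd_at m A \<longrightarrow> (\<forall>B\<in>H. B \<in> nbhd b A1 \<longrightarrow>
        (\<exists>A'\<in>H. A' \<in> nbhd_at m A1 \<and> nbhd b A' \<subseteq> nbhd b B)))"

lemma amalg_depth:
  assumes "A \<in> H" "b \<in> AR_below A" shows "amalg b (depth A b) A"
proof -
  have "\<exists>A'\<in>H. A' \<in> nbhd_at (depth A b) A1 \<and> nbhd b A' \<subseteq> nbhd b B"
    if "A1 \<in> H" "A1 \<in> nbhd_at (depth A b) A" "B \<in> H" "B \<in> nbhd b A1" for A1 B
    using coideal_amalgamate[of A1 b B] nbhd_at_compatible[of b A "depth A b" A1] that assms H_in_R
    by simp
  then show ?thesis using assms by (simp add: amalg_def)
qed

lemma amalg_mono: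
  assumes "amalg b m A" "A1 \<in> H" "A1 \<in> nbhd_at m A" shows "amalg b m A1"
proof -
  have "A \<in> R" using assms H_in_R by (simp add: amalg_def)
  then show ?thesis
    using assms nbhd_at_compatible[of b A m A1] nbhd_at_trans[of _ m A1 m A] by (simp add: amalg_def)
qed

text \<open>Clause (3) preserves \<open>A\<close> only up to the depth of \<open>b\<close>. The
  homogeneous \<open>B0\<close> is therefore shrunk to a member of \<open>H\<close> in
  \<open>nbhd b B0\<close>, and \<open>amalg\<close> transfers homogeneity to some \<open>A'\<close>
  that agrees with \<open>A\<close> up to \<open>m\<close>.\<close>

lemma amalg_pigeonhole:
  assumes "amalg b m A"
  shows "\<exists>B\<in>H. B \<in> nbhd_at m A \<and>
    ((\<forall>C\<in>nbhd b B. P (r (len b + 1) C)) \<or> (\<forall>C\<in>nbhd b B. \<not> P (r (len b + 1) C)))"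
proof -
  have A: "A \<in> H" "A \<in> R" "b \<in> AR_below A" using assms H_in_R by (auto simp: amalg_def)
  obtain B0 where B0: "B0 \<in> H" "B0 \<in> nbhd_at (depth A b) A"
    "(\<forall>C\<in>nbhd b B0. P (r (len b + 1) C)) \<or> (\<forall>C\<in>nbhd b B0. \<not> P (r (len b + 1) C))"
    using coideal_pigeonhole[of A b P] A by auto
  then obtain B where B: "B \<in> H" "B \<in> nbhd b B0"
    using coideal_meets nbhd_at_compatible(1)[of b A "depth A b" B0] A by blast
  have "B0 \<sqsubseteq> A" using B0 A by (simp add: nbhd_at_iff)
  then have "B \<in> nbhd b A" using nbhd_mono[of B0 A b] B B0 A H_in_R by blast
  then obtain A' where A': "A' \<in> H" "A' \<in> nbhd_at m A" "nbhd b A' \<subseteq> nbhd b B"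
    using assms B nbhd_at_refl[of A m] A unfolding amalg_def by blast
  have "nbhd b B \<subseteq> nbhd b B0" using B B0 H_in_R by (intro nbhd_mono) (auto simp: nbhd_iff)
  then show ?thesis using A' B0(3) by blast
qed

text \<open>The pigeonhole is applied to equality with \<open>c\<close>. Since \<open>c\<close> has
  depth at most \<open>m\<close>, it stays compatible with \<open>B\<close>, so the alternative
  excluding \<open>c\<close> is impossible. Below \<open>B\<close> the neighbourhoods of
  \<open>b\<close> and \<open>c\<close> then coincide, and \<open>c\<close> takes over the
  amalgamation property.\<close>

lemma amalg_forced:
  assumes am: "amalg b m A" and C: "C \<in> nbhd b A" and c: "c = r (len b + 1) C" and d: "depth A c \<le> m"
  shows "\<exists>A'\<in>H. A' \<in> nbhd_at m A \<and> amalg c m A'"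
proof -
  have A: "A \<in> H" "A \<in> R" using am H_in_R by (auto simp: amalg_def)
  have CR: "C \<in> R" "C \<sqsubseteq> A" "r (len b) C = b" using C by (auto simp: nbhd_iff)
  have cA: "c \<in> AR_below A" using CR AR_below_r c by simp
  have lc: "len c = len b + 1" using c CR len_r by simp
  obtain B where B: "B \<in> H" "B \<in> nbhd_at m A"
    "(\<forall>C\<in>nbhd b B. r (len b + 1) C = c) \<or> (\<forall>C\<in>nbhd b B. r (len b + 1) C \<noteq> c)"
    using amalg_pigeonhole[OF am, of "\<lambda>x. x = c"] by auto
  have cb: "nbhd c D \<subseteq> nbhd b D" for D
    using r_eq_initial[of _ C "len c" "len b"] CR c lc by (auto simp: nbhd_iff)
  have cB: "c \<in> AR_below B" "depth B c \<le> m" using nbhd_at_compatible[of c A m B] cA A d B by auto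
  then have all: "r (len b + 1) D = c" if "D \<in> nbhd b B" for D
  proof -
    obtain E where E: "E \<in> nbhd c B" using cB(1) unfolding AR_below_iff by blast
    then have "E \<in> nbhd b B" "r (len b + 1) E = c" using cb lc by (blast, simp add: nbhd_iff)
    then show ?thesis using B(3) that by blast
  qed
  have BR: "B \<in> R" using B(1) H_in_R by blast
  have eq: "nbhd c D = nbhd b D" if "D \<in> R" "D \<sqsubseteq> B" for D
  proof
    show "nbhd c D \<subseteq> nbhd b D" by (rule cb)
    show "nbhd b D \<subseteq> nbhd c D"
    proof
      fix E assume E: "E \<in> nbhd b D"
      then have "r (len c) E = c" using all nbhd_mono[OF that(2) BR that(1), of b] lc by auto
      then show "E \<in> nbhd c D" using E by (simp add: nbhd_iff)
    qed
  qed
  have amB: "amalg b m B" using amalg_mono am B by blast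
  have "\<exists>A'\<in>H. A' \<in> nbhd_at m A1 \<and> nbhd c A' \<subseteq> nbhd c D"
    if h: "A1 \<in> H" "A1 \<in> nbhd_at m B" "D \<in> H" "D \<in> nbhd c A1" for A1 D
  proof -
    have A1: "A1 \<in> R" "A1 \<sqsubseteq> B" using h(2) BR by (auto simp: nbhd_at_iff)
    have D: "D \<in> R" "D \<sqsubseteq> A1" using h(4) by (auto simp: nbhd_iff)
    have DB: "D \<sqsubseteq> B" using le_transD[OF D(2) A1(2) D(1) A1(1) BR] .
    obtain A' where A': "A' \<in> H" "A' \<in> nbhd_at m A1" "nbhd b A' \<subseteq> nbhd b D"
      using amB h eq[OF A1] unfolding amalg_def by blast
    have "A' \<in> R" "A' \<sqsubseteq> A1" using A'(2) A1 by (auto simp: nbhd_at_iff)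
    then have "A' \<in> R" "A' \<sqsubseteq> B" using le_transD A1 BR by blast+
    then show ?thesis using A' eq[of A'] eq[OF D(1) DB] by auto
  qed
  then have "amalg c m B" using B(1) cB unfolding amalg_def by blast
  then show ?thesis using B by blast
qed

section \<open>Fusion for a hereditary and dense property\<close>

context
  fixes S :: "'a \<Rightarrow> 'r \<Rightarrow> bool" and A0 :: 'r
  assumes A0: "A0 \<in> R"
    and S_mono: "\<And>a A A'. A \<in> H \<Longrightarrow> A' \<in> H \<Longrightarrow> A' \<sqsubseteq> A \<Longrightarrow> S a A \<Longrightarrow> S a A'"
    and S_dense: "\<And>a A. A \<in> H \<Longrightarrow> A \<sqsubseteq> A0 \<Longrightarrow> a \<in> AR_below A \<Longrightarrow>
      \<exists>A'\<in>H. A' \<in> nbhd_at (depth A a) A \<and> S a A'"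
begin

lemma le_A0: "B \<in> nbhd_at m A \<Longrightarrow> A \<in> R \<Longrightarrow> A \<sqsubseteq> A0 \<Longrightarrow> B \<sqsubseteq> A0"
  using le_transD[of B A A0] A0 by (simp add: nbhd_at_iff)

text \<open>By (A.4) only finitely many approximations have depth \<open>j\<close>, and they are
  settled one at a time. Each step preserves level \<open>j\<close>, so it creates no new ones of
  that depth, and \<open>S_mono\<close> keeps the earlier ones settled.\<close>

lemma settle_level:
  assumes A: "A \<in> H" "A \<sqsubseteq> A0"
  shows "\<exists>A'\<in>H. A' \<in> nbhd_at j A \<and> (\<forall>a\<in>AR_below A'. depth A' a = j \<longrightarrow> S a A')"
proof -
  have AR: "A \<in> R" using A H_in_R by blast
  have "\<exists>A'\<in>H. A' \<in> nbhd_at j A \<and> (\<forall>a\<in>F. a \<in> AR_below A' \<longrightarrow> depth A' a = j \<longrightarrow> S a A')"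
    if "finite F" for F
    using that
  proof (induction F)
    case empty
    then show ?case using A AR nbhd_at_refl by auto
  next
    case (insert x F)
    then obtain A' where A': "A' \<in> H" "A' \<in> nbhd_at j A"
      "\<And>a. a \<in> F \<Longrightarrow> a \<in> AR_below A' \<Longrightarrow> depth A' a = j \<Longrightarrow> S a A'" by blast
    have A'R: "A' \<in> R" using A' H_in_R by blast
    show ?case
    proof (cases "x \<in> AR_below A' \<and> depth A' x = j")
      case False
      then show ?thesis using A' by blast
    next
      case True
      then obtain D where D: "D \<in> H" "D \<in> nbhd_at j A'" "S x D"
        using S_dense[of A' x] A' le_A0[OF A'(2) AR A(2)] by blast
      have "S a D" if "a \<in> F" "a \<in> AR_below D" "depth D a = j" for a
      proof -
        have "a \<in> AR_below A'" "depth A' a = j"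
          using depth_nbhd_at_eq[OF D(2) A'R that(2)] that(3) by auto
        then have "S a A'" using A'(3) that(1) by blast
        moreover have "D \<sqsubseteq> A'" using D(2) A'R by (simp add: nbhd_at_iff)
        ultimately show ?thesis using S_mono A'(1) D(1) by blast
      qed
      then show ?thesis using D nbhd_at_trans[OF D(2) A'(2) order_refl AR] by blast
    qed
  qed
  from this[OF finite_below_r[OF AR, of j]] obtain A' where A': "A' \<in> H" "A' \<in> nbhd_at j A"
    "\<And>a. a \<in> AR_below A \<Longrightarrow> depth A a \<le> j \<Longrightarrow> a \<in> AR_below A' \<Longrightarrow> depth A' a = j \<Longrightarrow> S a A'"
    by blast
  have "S a A'" if "a \<in> AR_below A'" "depth A' a = j" for a
    using A'(3)[OF _ _ that] depth_nbhd_at_eq[OF A'(2) AR that(1)] that(2) by simp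
  then show ?thesis using A' by blast
qed

text \<open>One fusion step from \<open>(A, m)\<close> to \<open>(A', m')\<close> when the guide
  reads \<open>c\<close>. The conjunct \<open>amalg c m' A'\<close> is what allows the next step to
  start from \<open>c\<close>.\<close>

definition reaches :: "nat \<Rightarrow> 'r \<Rightarrow> 'a \<Rightarrow> 'r \<Rightarrow> nat \<Rightarrow> bool" where
  "reaches m A c A' m' \<longleftrightarrow> A' \<in> H \<and> A' \<in> nbhd_at m A \<and> m \<le> m' \<and> amalg c m' A' \<and>
     (\<forall>a\<in>AR_below A'. m < depth A' a \<and> depth A' a \<le> m' \<longrightarrow> S a A')"

lemma reaches_trans:
  assumes "reaches m B c A' m'" "B \<in> nbhd_at m A" "A \<in> R" shows "reaches m A c A' m'"
  using assms nbhd_at_trans[of A' m B m A] unfolding reaches_def by blast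

lemma settled_chain:
  assumes A: "A \<in> H" "A \<sqsubseteq> A0"
  obtains f B where "\<And>i. f i \<in> H" "\<And>i. f i \<in> nbhd_at m A"
    "\<And>i a. a \<in> AR_below (f i) \<Longrightarrow> m < depth (f i) a \<Longrightarrow> depth (f i) a \<le> m + i \<Longrightarrow> S a (f i)"
    "B \<in> R" "\<And>i. B \<in> nbhd_at (m + i) (f i)"
proof -
  have AR: "A \<in> R" using A H_in_R by blast
  define nx where "nx D j = (SOME A'. A' \<in> H \<and> A' \<in> nbhd_at j D \<and>
    (\<forall>a\<in>AR_below A'. depth A' a = j \<longrightarrow> S a A'))" for D j
  have nx: "nx D j \<in> H \<and> nx D j \<in> nbhd_at j D \<and>
    (\<forall>a\<in>AR_below (nx D j). depth (nx D j) a = j \<longrightarrow> S a (nx D j))"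
    if "D \<in> H" "D \<sqsubseteq> A0" for D j
    unfolding nx_def by (rule someI_ex) (use settle_level[OF that, of j] in blast)
  \<comment> \<open>At stage 0 the range of depths above \<open>m\<close> and at most
    \<open>m\<close> is empty, so \<open>A\<close> itself can start; the first level to be settled
    is \<open>m + 1\<close>.\<close>
  define f where "f = rec_nat A (\<lambda>i D. nx D (m + Suc i))"
  have f0: "f 0 = A" and fS: "f (Suc i) = nx (f i) (m + Suc i)" for i by (simp_all add: f_def)
  have f: "f i \<in> H \<and> f i \<in> nbhd_at m A \<and>
    (\<forall>a\<in>AR_below (f i). m < depth (f i) a \<and> depth (f i) a \<le> m + i \<longrightarrow> S a (f i))" for i
  proof (induction i)
    case 0
    then show ?case using A AR nbhd_at_refl f0 by auto
  next
    case (Suc i)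
    then have i: "f i \<in> H" "f i \<in> nbhd_at m A" "f i \<in> R" using H_in_R by auto
    have n: "f (Suc i) \<in> H" "f (Suc i) \<in> nbhd_at (m + Suc i) (f i)"
      "\<And>a. a \<in> AR_below (f (Suc i)) \<Longrightarrow> depth (f (Suc i)) a = m + Suc i \<Longrightarrow> S a (f (Suc i))"
      using nx[OF i(1) le_A0[OF i(2) AR A(2)], of "m + Suc i"] by (auto simp: fS)
    have "S a (f (Suc i))"
      if a: "a \<in> AR_below (f (Suc i))" "m < depth (f (Suc i)) a" "depth (f (Suc i)) a \<le> m + Suc i" for a
    proof (cases "depth (f (Suc i)) a = m + Suc i")
      case True then show ?thesis using n(3) a(1) by blast
    next
      case False
      then have "S a (f i)"
        using depth_nbhd_at_eq[OF n(2) i(3) a(1,3)] a Suc.IH by auto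
      moreover have "f (Suc i) \<sqsubseteq> f i" using n(2) i(3) by (simp add: nbhd_at_iff)
      ultimately show ?thesis using S_mono i(1) n(1) by blast
    qed
    moreover have "f (Suc i) \<in> nbhd_at m A" using nbhd_at_trans[OF n(2) i(2) _ AR] by simp
    ultimately show ?case using n(1) by blast
  qed
  have fR: "f i \<in> R" for i using f H_in_R by blast
  have step: "f (Suc i) \<in> nbhd_at (m + i) (f i)" for i
  proof -
    have "f i \<in> H" "f i \<sqsubseteq> A0" using f le_A0[of "f i" m A] AR A(2) by auto
    then have "f (Suc i) \<in> nbhd_at (m + Suc i) (f i)" using nx fS by simp
    then show ?thesis using nbhd_at_antimono fR by simp
  qed
  have "\<exists>B\<in>R. \<forall>i. B \<in> nbhd_at (m + i) (f i)"
    by (rule limit_exists) (use fR step in \<open>auto intro: le_add2\<close>)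
  then show thesis using f that by blast
qed

text \<open>
  Otherwise the pigeonhole clause gives an \<open>A1\<close> below which no one-step extension of \<open>b\<close> is reached.
  But a settled chain from \<open>A1\<close> has a limit, possibly outside \<open>H\<close>, that is compatible with \<open>b\<close>, and
  any one-step extension of \<open>b\<close> below that limit is reached at a finite stage.
\<close>

lemma reaches_extensions:
  assumes am: "amalg b m A" and le: "A \<sqsubseteq> A0"
  shows "\<exists>A1\<in>H. A1 \<in> nbhd_at m A \<and> (\<forall>C\<in>nbhd b A1. \<exists>A' m'. reaches m A (r (len b + 1) C) A' m')"
proof -
  have A: "A \<in> H" "A \<in> R" using am H_in_R by (auto simp: amalg_def)
  obtain A1 where A1: "A1 \<in> H" "A1 \<in> nbhd_at m A"
    "(\<forall>C\<in>nbhd b A1. \<exists>A' m'. reaches m A (r (len b + 1) C) A' m') \<or>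
     (\<forall>C\<in>nbhd b A1. \<not> (\<exists>A' m'. reaches m A (r (len b + 1) C) A' m'))"
    using amalg_pigeonhole[OF am, of "\<lambda>c. \<exists>A' m'. reaches m A c A' m'"] by blast
  have A1R: "A1 \<in> R" using A1 H_in_R by blast
  have am1: "amalg b m A1" using amalg_mono[OF am A1(1,2)] .
  obtain f B where f: "\<And>i. f i \<in> H" "\<And>i. f i \<in> nbhd_at m A1"
    "\<And>i a. a \<in> AR_below (f i) \<Longrightarrow> m < depth (f i) a \<Longrightarrow> depth (f i) a \<le> m + i \<Longrightarrow> S a (f i)"
    and B: "B \<in> R" "\<And>i. B \<in> nbhd_at (m + i) (f i)"
    using settled_chain[OF A1(1) le_A0[OF A1(2) A(2) le], of m] by metis
  have fR: "f i \<in> R" for i using f H_in_R by blast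
  have BA1: "B \<in> nbhd_at m A1" using nbhd_at_trans[OF B(2)[of 0] f(2)] A1R by simp
  have "b \<in> AR_below B" using nbhd_at_compatible(1)[of b A1 m B] am1 BA1 A1R by (simp add: amalg_def)
  then obtain C where C: "C \<in> nbhd b B" by (auto simp: AR_below_iff)
  define c where "c = r (len b + 1) C"
  have CR: "C \<in> R" "C \<sqsubseteq> B" using C by (auto simp: nbhd_iff)
  have cB: "c \<in> AR_below B" using CR AR_below_r c_def by simp
  have CA1: "C \<in> nbhd b A1" using C nbhd_mono[of B A1 b] BA1 A1R B(1) by (auto simp: nbhd_at_iff)
  have "\<exists>A' m'. reaches m A1 c A' m'"
  proof (cases "depth B c \<le> m")
    case True
    then have "depth A1 c \<le> m" using depth_nbhd_at_eq(2)[OF BA1 A1R cB] by simp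
    then obtain A' where A': "A' \<in> H" "A' \<in> nbhd_at m A1" "amalg c m A'"
      using amalg_forced[OF am1 CA1 c_def] by blast
    \<comment> \<open>With both levels equal to \<open>m\<close> there are no depths to
      settle.\<close>
    then have "reaches m A1 c A' m" by (auto simp: reaches_def)
    then show ?thesis by blast
  next
    case False
    \<comment> \<open>A depth of \<open>m + i\<close> is handled by the stage \<open>f i\<close>,
      which agrees with \<open>B\<close> up to that level.\<close>
    then obtain i where i: "depth B c = m + i" by (metis le_add_diff_inverse nat_le_linear)
    have ci: "c \<in> AR_below (f i)" "depth (f i) c = m + i"
      using depth_nbhd_at_eq[OF B(2)[of i] fR cB] i by auto
    have "amalg c (m + i) (f i)" using amalg_depth[OF f(1) ci(1)] ci(2) by simp
    then have "reaches m A1 c (f i) (m + i)" using f by (auto simp: reaches_def)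
    then show ?thesis by blast
  qed
  then have "\<exists>A' m'. reaches m A c A' m'" using reaches_trans A1(2) A(2) by blast
  then show ?thesis using A1 CA1 c_def by blast
qed

text \<open>Selectivity is applied to the family \<open>F\<close> that sends an approximation to an
  improvement of the stage reached after reading it. The states along the resulting guide
  \<open>B\<close> form a fusion sequence with limit \<open>E\<close>, and \<open>d\<close> is the
  level \<open>M 0\<close> at which that sequence starts.\<close>

lemma fusion:
  assumes A: "A \<in> H" "A \<sqsubseteq> A0"
  shows "\<exists>B\<in>H. \<exists>d. B \<in> nbhd_at n A \<and> (\<forall>a\<in>AR_below B. d < depth B a \<longrightarrow> S a B)"
proof -
  have AR: "A \<in> R" using A H_in_R by blast
  define hm where "hm b D m = (SOME A1. A1 \<in> H \<and> A1 \<in> nbhd_at m D \<and>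
    (\<forall>C\<in>nbhd b A1. \<exists>A' m'. reaches m D (r (len b + 1) C) A' m'))" for b D m
  have hm: "hm b D m \<in> H \<and> hm b D m \<in> nbhd_at m D \<and>
    (\<forall>C\<in>nbhd b (hm b D m). \<exists>A' m'. reaches m D (r (len b + 1) C) A' m')"
    if "amalg b m D" "D \<sqsubseteq> A" for b D m
  proof -
    have "D \<in> R" using that(1) H_in_R by (simp add: amalg_def)
    then have le: "D \<sqsubseteq> A0" using le_transD[OF that(2) A(2) _ AR A0] by blast
    show ?thesis
      unfolding hm_def by (rule someI_ex) (use reaches_extensions[OF that(1) le] in blast)
  qed
  define nx where "nx m D c = (SOME p. reaches m D c (fst p) (snd p))" for m D c
  have nx: "reaches m D c (fst (nx m D c)) (snd (nx m D c))" if "reaches m D c A' m'" for m D c A' m'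
    unfolding nx_def by (rule someI[of _ "(A', m')"]) (simp add: that)
  \<comment> \<open>Waiting for depth \<open>n\<close> makes the starting level at least
    \<open>n\<close>, so that the limit agrees with \<open>A\<close> up to \<open>n\<close>.\<close>
  define start where
    "start c = (if n \<le> depth A c then Some (A, depth A c) else None)" for c
  \<comment> \<open>the state of the fusion after reading \<open>r k C\<close>; it is \<open>None\<close> until the depth reaches \<open>n\<close>\<close>
  define st where "st C = rec_nat (start (r 0 C)) (\<lambda>k s. case s of
    None \<Rightarrow> start (r (Suc k) C) | Some (D, m) \<Rightarrow> Some (nx m D (r (Suc k) C)))" for C
  have st0: "st C 0 = start (r 0 C)" and stS: "st C (Suc k) = (case st C k of
    None \<Rightarrow> start (r (Suc k) C) | Some (D, m) \<Rightarrow> Some (nx m D (r (Suc k) C)))" for C k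
    by (simp_all add: st_def)
  have st_cong: "st C k = st C' k" if "C \<in> R" "C' \<in> R" "r k C = r k C'" for C C' k
    using that(3)
  proof (induction k)
    case 0 then show ?case by (simp add: st0)
  next
    case (Suc k)
    then show ?case using r_eq_initial[OF that(1,2) Suc.prems, of k]
      by (auto simp: stS split: option.split)
  qed
  \<comment> \<open>By \<open>st_cong\<close> the state after \<open>k\<close> steps depends only on
    \<open>r k C\<close>. A representative therefore turns it into a function of the approximation,
    as selectivity demands.\<close>
  define rep where "rep a = (SOME C. C \<in> R \<and> r (len a) C = a)" for a
  have st_rep: "st (rep (r k C)) k = st C k" if "C \<in> R" for C k
  proof -
    have "rep (r k C) \<in> R \<and> r (len (r k C)) (rep (r k C)) = r k C"
      unfolding rep_def by (rule someI[of _ C]) (simp add: that len_r)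
    then show ?thesis using st_cong[of "rep (r k C)" C k] that len_r[OF that, of k] by auto
  qed
  define I where
    "I = {a \<in> AR. \<exists>D m. st (rep a) (len a) = Some (D, m) \<and> amalg a m D \<and> D \<sqsubseteq> A}"
  define F where "F a = (case the (st (rep a) (len a)) of (D, m) \<Rightarrow> hm a D m)" for a
  have F: "F a \<in> restr H A \<and> nbhd a (F a) \<noteq> {}" if aI: "a \<in> I" for a
  proof -
    obtain D m where D: "st (rep a) (len a) = Some (D, m)" "amalg a m D" "D \<sqsubseteq> A"
      using aI by (auto simp: I_def)
    have DR: "D \<in> R" using D(2) H_in_R by (simp add: amalg_def)
    have Fa: "F a = hm a D m" by (simp add: F_def D(1))
    have h: "F a \<in> H" "F a \<in> nbhd_at m D" using hm[OF D(2,3)] Fa by auto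
    then have "F a \<sqsubseteq> A" using le_transD[of "F a" D A] DR D(3) AR by (simp add: nbhd_at_iff)
    moreover have "a \<in> AR_below (F a)" using amalg_mono[OF D(2) h] by (simp add: amalg_def)
    ultimately show ?thesis using h by (simp add: restr_def AR_below_iff)
  qed
  have "I \<subseteq> AR" by (auto simp: I_def)
  from selective[unfolded selective_def, rule_format, OF A(1) this F]
  obtain B where B: "B \<in> restr H A"
    "\<And>a. a \<in> I \<Longrightarrow> a \<in> AR_below B \<Longrightarrow> nbhd a B \<subseteq> nbhd a (F a)" by blast
  have BH: "B \<in> H" "B \<in> R" "B \<sqsubseteq> A" using B(1) H_in_R by (auto simp: restr_def)
  have step: "\<exists>D' m'. st B (Suc k) = Some (D', m') \<and> reaches m D (r (Suc k) B) D' m' \<and> D' \<sqsubseteq> A"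
    if k: "st B k = Some (D, m)" "amalg (r k B) m D" "D \<sqsubseteq> A" for k D m
  proof -
    let ?b = "r k B"
    have DR: "D \<in> R" using k(2) H_in_R by (simp add: amalg_def)
    have st_b: "st (rep ?b) (len ?b) = Some (D, m)" using st_rep k(1) BH len_r by simp
    then have "?b \<in> I" using k BH r_in_AR unfolding I_def by blast
    then have "nbhd ?b B \<subseteq> nbhd ?b (F ?b)" using B(2) AR_below_r[OF BH(2) le_reflI] BH by blast
    moreover have "F ?b = hm ?b D m" by (simp add: F_def st_b)
    moreover have "B \<in> nbhd ?b B" using BH le_reflI by (auto simp: nbhd_def)
    \<comment> \<open>\<open>B\<close> itself lies in this neighbourhood, so its own next
      approximation is one that some stage reaches.\<close>
    ultimately have "B \<in> nbhd ?b (hm ?b D m)" by auto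
    then have "\<exists>A' m'. reaches m D (r (Suc k) B) A' m'"
      using hm[OF k(2,3)] len_r BH by fastforce
    then have re: "reaches m D (r (Suc k) B) (fst (nx m D (r (Suc k) B))) (snd (nx m D (r (Suc k) B)))"
      using nx by blast
    then have "fst (nx m D (r (Suc k) B)) \<sqsubseteq> A"
      using le_transD[of _ D A] DR k(3) AR by (simp add: reaches_def nbhd_at_iff)
    then show ?thesis using re k(1) by (intro exI conjI) (auto simp: stS)
  qed
  define K where "K = (LEAST k. n \<le> depth A (r k B))"
  have K: "n \<le> depth A (r K B)"
    unfolding K_def by (rule LeastI_ex) (rule depth_r_unbounded[OF BH(2) AR BH(3)])
  have below_K: "depth A (r k B) < n" if "k < K" for k
    using not_less_Least[of k "\<lambda>k. n \<le> depth A (r k B)"] that by (simp add: K_def)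
  have None_below: "st B k = None" if "k < K" for k
    using that
  proof (induction k)
    case 0 then show ?case using below_K[of 0] by (simp add: st0 start_def)
  next
    case (Suc k) then show ?case using below_K[of "Suc k"] by (simp add: stS start_def)
  qed
  have st_K: "st B K = Some (A, depth A (r K B))"
    using K None_below[of "K - 1"] by (cases K) (simp_all add: st0 stS start_def)
  define D where "D i = fst (the (st B (K + i)))" for i
  define M where "M i = snd (the (st B (K + i)))" for i
  have DM0: "D 0 = A" "M 0 = depth A (r K B)" using st_K by (simp_all add: D_def M_def)
  have good: "st B (K + i) = Some (D i, M i) \<and> amalg (r (K + i) B) (M i) (D i) \<and> D i \<sqsubseteq> A" for i
  proof (induction i)
    case 0
    then show ?case
      using DM0 st_K amalg_depth[OF A(1) AR_below_r[OF BH(2,3), of K]] le_reflI AR by simp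
  next
    case (Suc i)
    then obtain D' m' where D': "st B (Suc (K + i)) = Some (D', m')"
      "reaches (M i) (D i) (r (Suc (K + i)) B) D' m'" "D' \<sqsubseteq> A"
      using step by blast
    then have "D (Suc i) = D'" "M (Suc i) = m'" by (simp_all add: D_def M_def)
    then show ?case using D' by (simp add: reaches_def)
  qed
  have re: "reaches (M i) (D i) (r (Suc (K + i)) B) (D (Suc i)) (M (Suc i))" for i
    using step[of "K + i" "D i" "M i"] good[of i] good[of "Suc i"] by auto
  have DH: "D i \<in> H" "D i \<in> R" for i using good[of i] H_in_R by (auto simp: amalg_def)
  have Dstep: "D (Suc i) \<in> nbhd_at (M i) (D i)" and Mmono: "M i \<le> M (Suc i)" for i
    using re[of i] by (auto simp: reaches_def)
  have bD: "r (K + i) B \<in> AR_below (D i)" "depth (D i) (r (K + i) B) \<le> M i" for i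
    using good[of i] by (auto simp: amalg_def)
  \<comment> \<open>If the levels were bounded, with maximum \<open>M i0\<close>, all later
    approximations of \<open>B\<close> would be among the finitely many of depth at most
    \<open>M i0\<close> in \<open>D i0\<close>.\<close>
  have unb: "\<exists>i. N \<le> M i" for N
  proof (rule ccontr)
    assume "\<nexists>i. N \<le> M i"
    then have "\<forall>i. M i < N" by (simp add: not_le)
    then obtain i0 where i0: "\<And>i. M i \<le> M i0"
      using ex_has_greatest_nat[of "\<lambda>_. True" 0 M N] by auto
    have "r (K + i) B \<in> {a \<in> AR_below (D i0). depth (D i0) a \<le> M i0}" if "i0 \<le> i" for i
    proof -
      have "D i \<in> nbhd_at (M i0) (D i0)"
        by (rule nbhd_at_chain[of D M, OF DH(2) Dstep Mmono that])
      moreover have "depth (D i) (r (K + i) B) \<le> M i0" using bD(2)[of i] i0[of i] by simp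
      ultimately show ?thesis using depth_nbhd_at_eq[OF _ DH(2) bD(1)] by simp
    qed
    then have "(\<lambda>k. r k B) ` {K + i0..} \<subseteq> {a \<in> AR_below (D i0). depth (D i0) a \<le> M i0}"
      by (auto simp: le_iff_add add.assoc)
    then have "finite ((\<lambda>k. r k B) ` {K + i0..})" using finite_below_r[OF DH(2)] finite_subset by blast
    then have "finite {K + i0..}" using finite_imageD inj_r[OF BH(2)] inj_on_subset by blast
    then show False using infinite_Ici by blast
  qed
  obtain E where E: "E \<in> R" "\<And>i. E \<in> nbhd_at (M i) (D i)"
    using limit_exists[of D M, OF DH(2) Dstep Mmono unb] by blast
  \<comment> \<open>Every approximation of \<open>B\<close> lies below a part of some stage that
    \<open>E\<close> retains. Hence \<open>B\<close> is below \<open>E\<close>, and upward closure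
    puts \<open>E\<close> in \<open>H\<close>.\<close>
  have "\<exists>m. r k B \<sqsubseteq>\<^sub>f\<^sub>i\<^sub>n r m E" for k
  proof (cases "k < K")
    case True
    have "r k B \<sqsubseteq>\<^sub>f\<^sub>i\<^sub>n r (depth A (r k B)) A" using lefin_depth AR_below_r BH AR by blast
    moreover have "depth A (r k B) \<le> M 0" using below_K[OF True] K DM0 by simp
    ultimately have "r k B \<sqsubseteq>\<^sub>f\<^sub>i\<^sub>n r (depth A (r k B)) E"
      using nbhd_at_r[OF E(2)[of 0], of "depth A (r k B)"] DM0(1) AR by simp
    then show ?thesis ..
  next
    case False
    then obtain i where k: "k = K + i" by (metis le_iff_add not_less)
    have "r k B \<sqsubseteq>\<^sub>f\<^sub>i\<^sub>n r (depth (D i) (r k B)) (D i)" using lefin_depth bD(1) DH(2) k by blast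
    then have "r k B \<sqsubseteq>\<^sub>f\<^sub>i\<^sub>n r (depth (D i) (r k B)) E"
      using nbhd_at_r[OF E(2)[of i] bD(2) DH(2)] k by simp
    then show ?thesis ..
  qed
  then have "B \<sqsubseteq> E" using A4_le[OF BH(2) E(1)] by blast
  then have EH: "E \<in> H" using H_upward[OF BH(1) _ E(1)] by blast
  have EA: "E \<in> nbhd_at n A" using nbhd_at_antimono[OF E(2)[of 0], of n] DM0 K AR by simp
  have "S a E" if a: "a \<in> AR_below E" "M 0 < depth E a" for a
  proof -
    \<comment> \<open>\<open>j\<close> is the first stage whose level reaches the depth of
      \<open>a\<close>. It is not 0, so the step into stage \<open>j\<close> settled
      \<open>a\<close>.\<close>
    define j where "j = (LEAST i. depth E a \<le> M i)"
    have j: "depth E a \<le> M j" unfolding j_def by (rule LeastI_ex) (rule unb)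
    then obtain i where i: "j = Suc i" using a(2) by (cases j) auto
    have "M i < depth E a" using not_less_Least[of i "\<lambda>i. depth E a \<le> M i"] i by (simp add: j_def)
    moreover have "a \<in> AR_below (D j)" "depth (D j) a = depth E a"
      using depth_nbhd_at_eq[OF E(2) DH(2) a(1) j] by auto
    ultimately have "S a (D j)" using re[of i] j i by (simp add: reaches_def)
    moreover have "E \<sqsubseteq> D j" using E(2) DH(2) by (simp add: nbhd_at_iff)
    ultimately show ?thesis using S_mono DH(1) EH by blast
  qed
  then show ?thesis using EH EA by blast
qed

text \<open>After \<open>fusion\<close> only finitely many approximations, of depth at most
  \<open>d\<close>, remain. Each is settled at the level of its own depth, which keeps it
  compatible; \<open>a0\<close> then stays compatible too, because only extensions of
  \<open>a0\<close> are treated.\<close>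

lemma settle_extensions:
  assumes A: "A \<in> H" "A \<sqsubseteq> A0" and a0: "a0 \<in> AR_below A"
  shows "\<exists>B\<in>H. B \<sqsubseteq> A \<and> a0 \<in> AR_below B \<and> (\<forall>a\<in>AR_below B. extends a0 a \<longrightarrow> S a B)"
proof -
  have AR: "A \<in> R" using A H_in_R by blast
  obtain B1 d where B1: "B1 \<in> H" "B1 \<in> nbhd_at (depth A a0) A"
    "\<And>a. a \<in> AR_below B1 \<Longrightarrow> d < depth B1 a \<Longrightarrow> S a B1"
    using fusion[OF A] by blast
  have B1R: "B1 \<in> R" "B1 \<sqsubseteq> A" using B1 AR by (auto simp: nbhd_at_iff)
  have a01: "a0 \<in> AR_below B1" using nbhd_at_compatible(1)[OF a0 AR order_refl B1(2)] .
  have "\<exists>B\<in>H. B \<sqsubseteq> B1 \<and> a0 \<in> AR_below B \<and> (\<forall>a\<in>F. a \<in> AR_below B \<longrightarrow> extends a0 a \<longrightarrow> S a B)"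
    if "finite F" for F
    using that
  proof (induction F)
    case empty
    then show ?case using B1 B1R a01 le_reflI by auto
  next
    case (insert x F)
    then obtain B where B: "B \<in> H" "B \<sqsubseteq> B1" "a0 \<in> AR_below B"
      "\<And>a. a \<in> F \<Longrightarrow> a \<in> AR_below B \<Longrightarrow> extends a0 a \<Longrightarrow> S a B" by blast
    have BR: "B \<in> R" using B H_in_R by blast
    show ?case
    proof (cases "x \<in> AR_below B \<and> extends a0 x")
      case False
      then show ?thesis using B by blast
    next
      case True
      have "B \<sqsubseteq> A" using le_transD[OF B(2) B1R(2) BR B1R(1) AR] .
      then have "B \<sqsubseteq> A0" using le_transD[OF _ A(2) BR AR A0] by blast
      then obtain D where D: "D \<in> H" "D \<in> nbhd_at (depth B x) B" "S x D"
        using S_dense B(1) True by blast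
      have DB: "D \<in> R" "D \<sqsubseteq> B" using D(2) BR by (auto simp: nbhd_at_iff)
      have "x \<in> AR_below D" using nbhd_at_compatible(1)[OF _ BR order_refl D(2)] True by blast
      then have "a0 \<in> AR_below D" using extends_nbhd True by (fastforce simp: AR_below_iff)
      moreover have "S a D" if "a \<in> F" "a \<in> AR_below D" "extends a0 a" for a
        using B(4)[OF that(1) AR_below_mono[OF that(2) DB(2) BR DB(1)] that(3)]
          S_mono[OF B(1) D(1) DB(2)] by blast
      moreover have "D \<sqsubseteq> B1" using le_transD[OF DB(2) B(2) DB(1) BR B1R(1)] .
      ultimately show ?thesis using D by blast
    qed
  qed
  from this[OF finite_below_r[OF B1R(1), of d]] obtain B where B: "B \<in> H" "B \<sqsubseteq> B1" "a0 \<in> AR_below B"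
    "\<And>a. a \<in> AR_below B1 \<Longrightarrow> depth B1 a \<le> d \<Longrightarrow> a \<in> AR_below B \<Longrightarrow> extends a0 a \<Longrightarrow> S a B"
    by blast
  have BR: "B \<in> R" using B H_in_R by blast
  have "S a B" if "a \<in> AR_below B" "extends a0 a" for a
  proof (cases "depth B1 a \<le> d")
    case True
    then show ?thesis using B(4) AR_below_mono[OF that(1) B(2) B1R(1) BR] that by blast
  next
    case False
    then have "S a B1" using B1(3) AR_below_mono[OF that(1) B(2) B1R(1) BR] by simp
    then show ?thesis using S_mono[OF B1(1) B(1,2)] by blast
  qed
  then show ?thesis using B le_transD[OF B(2) B1R(2) BR B1R(1) AR] by blast
qed

end

section \<open>Equivalence of the Ramsey and Baire properties\<close>

lemma Ramsey_imp_Baire: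
  assumes "Ramsey_for H X" shows "Baire_for H X"
  unfolding Baire_for_def
proof (intro ballI impI)
  fix a A assume a: "a \<in> AR" "A \<in> H" "nbhd a A \<noteq> {}"
  then obtain B where B: "B \<in> nbhd a A" "B \<in> H" "nbhd a B \<noteq> {}"
    "nbhd a B \<subseteq> X \<or> nbhd a B \<subseteq> R - X"
    using assms unfolding Ramsey_for_def by blast
  have "nbhd a B \<subseteq> nbhd a A" using B(1) H_in_R[OF a(2)] by (intro nbhd_mono) (auto simp: nbhd_iff)
  then show "\<exists>b\<in>AR. \<exists>B\<in>H. nbhd b B \<noteq> {} \<and> nbhd b B \<subseteq> nbhd a A \<and>
      (nbhd b B \<subseteq> X \<or> nbhd b B \<subseteq> R - X)"
    using a(1) B by blast
qed

lemma Baire_imp_Ramsey: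
  assumes Baire: "Baire_for H X" shows "Ramsey_for H X"
  unfolding Ramsey_for_def
proof (intro ballI impI)
  fix a0 A assume "a0 \<in> AR" and A: "A \<in> H" and "nbhd a0 A \<noteq> {}"
  then have a0A: "a0 \<in> AR_below A" by (simp add: AR_below_iff)
  have AR: "A \<in> R" using A H_in_R by blast
  define decided where "decided a B \<longleftrightarrow> nbhd a B \<subseteq> X \<or> nbhd a B \<subseteq> R - X" for a B
  have decided_mono: "decided a B'" if "nbhd a B' \<subseteq> nbhd a B" "decided a B" for a B B'
    using that unfolding decided_def by blast
  \<comment> \<open>Decided or rejected by \<open>B\<close>; both alternatives are inherited by
    smaller members of \<open>H\<close>.\<close>
  define S1 where "S1 a B \<longleftrightarrow> decided a B \<or> (\<forall>D\<in>H. D \<in> nbhd a B \<longrightarrow> \<not> decided a D)" for a B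
  have S1_mono: "S1 a B'" if "B \<in> H" "B' \<in> H" "B' \<sqsubseteq> B" "S1 a B" for a B B'
    using nbhd_mono[OF that(3) H_in_R[OF that(1)] H_in_R[OF that(2)], of a]
      decided_mono[of a B' B] that(4) unfolding S1_def by blast
  have S1_dense: "\<exists>B'\<in>H. B' \<in> nbhd_at (depth B a) B \<and> S1 a B'"
    if B: "B \<in> H" "a \<in> AR_below B" for a B
  proof (cases "\<exists>D\<in>H. D \<in> nbhd a B \<and> decided a D")
    case True
    then obtain D where D: "D \<in> H" "D \<in> nbhd a B" "decided a D" by blast
    then obtain B' where "B' \<in> H" "B' \<in> nbhd_at (depth B a) B" "nbhd a B' \<subseteq> nbhd a D"
      using coideal_amalgamate[OF B D(1,2)] by blast
    then show ?thesis using decided_mono D(3) S1_def by blast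
  next
    case False
    then have "S1 a B" unfolding S1_def by blast
    then show ?thesis using B(1) nbhd_at_refl H_in_R by blast
  qed
  have "\<exists>B\<in>H. B \<sqsubseteq> A \<and> a0 \<in> AR_below B \<and> (\<forall>a\<in>AR_below B. extends a0 a \<longrightarrow> S1 a B)"
    by (rule settle_extensions[OF AR _ _ A le_reflI[OF AR] a0A])
      (erule (3) S1_mono, erule (1) S1_dense)
  then obtain B1 where B1: "B1 \<in> H" "B1 \<sqsubseteq> A" "a0 \<in> AR_below B1"
    "\<And>a. a \<in> AR_below B1 \<Longrightarrow> extends a0 a \<Longrightarrow> S1 a B1"
    by blast
  have B1R: "B1 \<in> R" using B1 H_in_R by blast
  \<comment> \<open>Rejection is fixed relative to \<open>B1\<close>, where \<open>S1\<close> leaves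
    compatible extensions of \<open>a0\<close> only the two alternatives.\<close>
  define rejected where "rejected a \<longleftrightarrow> (\<forall>D\<in>H. D \<in> nbhd a B1 \<longrightarrow> \<not> decided a D)" for a
  show "\<exists>B\<in>nbhd a0 A \<inter> H. nbhd a0 B \<noteq> {} \<and> (nbhd a0 B \<subseteq> X \<or> nbhd a0 B \<subseteq> R - X)"
  proof (cases "rejected a0")
    case False
    then obtain D where D: "D \<in> H" "D \<in> nbhd a0 B1" "decided a0 D" unfolding rejected_def by blast
    \<comment> \<open>The deciding \<open>D\<close> is itself the required witness: by reflexivity
      it belongs to its own neighbourhood \<open>nbhd a0 D\<close>.\<close>
    have "D \<in> nbhd a0 A" using nbhd_mono[OF B1(2) AR B1R] D(2) by blast
    moreover have "D \<in> nbhd a0 D" using D(2) le_reflI by (simp add: nbhd_iff)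
    ultimately show ?thesis using D unfolding decided_def by blast
  next
    case True
    define S2 where "S2 a B \<longleftrightarrow> (extends a0 a \<and> rejected a \<longrightarrow>
      (\<forall>C\<in>nbhd a B. rejected (r (len a + 1) C)))" for a B
    have S2_mono: "S2 a B'" if "B \<in> H" "B' \<in> H" "B' \<sqsubseteq> B" "S2 a B" for a B B'
      using nbhd_mono[OF that(3) H_in_R[OF that(1)] H_in_R[OF that(2)], of a] that(4)
      unfolding S2_def by blast
    have S2_dense: "\<exists>B'\<in>H. B' \<in> nbhd_at (depth B a) B \<and> S2 a B'"
      if B: "B \<in> H" "B \<sqsubseteq> B1" "a \<in> AR_below B" for a B
    proof (cases "extends a0 a \<and> rejected a")
      case False
      then have "S2 a B" unfolding S2_def by blast
      then show ?thesis using B(1) nbhd_at_refl H_in_R by blast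
    next
      case True
      have BR: "B \<in> R" using B H_in_R by blast
      \<comment> \<open>If the neighbourhoods in \<open>B1\<close> of all one-step extensions below
        \<open>E\<close> were inside \<open>Y\<close>, some \<open>G\<close> in \<open>H\<close>
        would decide \<open>a\<close>, against its rejection. Used for \<open>X\<close> and then for
        its complement, this leaves no one-step extension decided by \<open>B1\<close>.\<close>
      have pigeon: "\<exists>E\<in>H. E \<in> nbhd_at (depth B a) D \<and>
          (\<forall>C\<in>nbhd a E. \<not> nbhd (r (len a + 1) C) B1 \<subseteq> Y)"
        if D: "D \<in> H" "D \<in> nbhd_at (depth B a) B" and Y: "Y = X \<or> Y = R - X" for D Y
      proof -
        have DR: "D \<in> R" "D \<sqsubseteq> B" using D(2) BR by (auto simp: nbhd_at_iff)
        have aD: "a \<in> AR_below D" "depth D a = depth B a"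
          using nbhd_at_compatible[OF B(3) BR order_refl D(2)] by auto
        obtain E where E: "E \<in> H" "E \<in> nbhd_at (depth B a) D"
          "(\<forall>C\<in>nbhd a E. nbhd (r (len a + 1) C) B1 \<subseteq> Y) \<or>
           (\<forall>C\<in>nbhd a E. \<not> nbhd (r (len a + 1) C) B1 \<subseteq> Y)"
          using coideal_pigeonhole[OF D(1) aD(1), of "\<lambda>c. nbhd c B1 \<subseteq> Y"] aD(2) by auto
        have ER: "E \<in> R" "E \<sqsubseteq> D" using E(2) DR by (auto simp: nbhd_at_iff)
        have "E \<sqsubseteq> B" using le_transD[OF ER(2) DR(2) ER(1) DR(1) BR] .
        then have EB1: "E \<sqsubseteq> B1" using le_transD[OF _ B(2) ER(1) BR B1R] by blast
        have "a \<in> AR_below E"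
          using nbhd_at_compatible(1)[OF aD(1) DR(1) _ E(2)] aD(2) by simp
        then obtain G where G: "G \<in> H" "G \<in> nbhd a E" using coideal_meets E(1) by blast
        have GR: "G \<in> R" "G \<sqsubseteq> E" using G(2) by (auto simp: nbhd_iff)
        have "\<not> (\<forall>C\<in>nbhd a E. nbhd (r (len a + 1) C) B1 \<subseteq> Y)"
        proof
          assume all: "\<forall>C\<in>nbhd a E. nbhd (r (len a + 1) C) B1 \<subseteq> Y"
          have "nbhd a G \<subseteq> Y"
          proof
            fix C assume "C \<in> nbhd a G"
            then have C: "C \<in> nbhd a E" using nbhd_mono[OF GR(2) ER(1) GR(1)] by blast
            then have CR: "C \<in> R" "C \<sqsubseteq> E" by (auto simp: nbhd_iff)
            have "C \<sqsubseteq> B1" using le_transD[OF CR(2) EB1 CR(1) ER(1) B1R] .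
            then have "C \<in> nbhd (r (len a + 1) C) B1" using CR(1) by (auto simp: nbhd_def)
            then show "C \<in> Y" using all C by blast
          qed
          then have "decided a G" using Y unfolding decided_def by blast
          moreover have "G \<in> nbhd a B1" using nbhd_mono[OF EB1 B1R ER(1)] G(2) by blast
          ultimately show False using True G(1) unfolding rejected_def by blast
        qed
        then show ?thesis using E by blast
      qed
      obtain D where D: "D \<in> H" "D \<in> nbhd_at (depth B a) B"
        "\<And>C. C \<in> nbhd a D \<Longrightarrow> \<not> nbhd (r (len a + 1) C) B1 \<subseteq> X"
        using pigeon[OF B(1) nbhd_at_refl[OF BR], of X] by blast
      obtain E where E: "E \<in> H" "E \<in> nbhd_at (depth B a) D"
        "\<And>C. C \<in> nbhd a E \<Longrightarrow> \<not> nbhd (r (len a + 1) C) B1 \<subseteq> R - X"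
        using pigeon[OF D(1,2), of "R - X"] by blast
      have DR: "D \<in> R" using D H_in_R by blast
      have ER: "E \<in> R" "E \<sqsubseteq> D" using E(2) DR by (auto simp: nbhd_at_iff)
      have EB: "E \<in> nbhd_at (depth B a) B" using nbhd_at_trans[OF E(2) D(2) order_refl BR] .
      then have "E \<sqsubseteq> B" using BR by (simp add: nbhd_at_iff)
      then have EB1: "E \<sqsubseteq> B1" using le_transD[OF _ B(2) ER(1) BR B1R] by blast
      have "rejected (r (len a + 1) C)" if C: "C \<in> nbhd a E" for C
      proof -
        let ?c = "r (len a + 1) C"
        have CR: "C \<in> R" "C \<sqsubseteq> E" "r (len a) C = a" using C by (auto simp: nbhd_iff)
        have "C \<sqsubseteq> B1" using le_transD[OF CR(2) EB1 CR(1) ER(1) B1R] .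
        then have cB1: "?c \<in> AR_below B1" using AR_below_r CR(1) by blast
        have "C \<in> nbhd a0 E" using extends_nbhd True C by blast
        then have "r (len a0) C = a0" by (simp add: nbhd_iff)
        moreover have "len a0 \<le> len a"
          using True unfolding extends_def by (metis len_r)
        ultimately have "extends a0 ?c"
          unfolding extends_def
          by (intro bexI[of _ C] exI[of _ "len a0"] exI[of _ "len a + 1"]) (simp_all add: CR(1))
        then have "S1 ?c B1" using B1(4) cB1 by blast
        moreover have "\<not> decided ?c B1"
          using D(3) E(3)[OF C] nbhd_mono[OF ER(2) DR ER(1)] C unfolding decided_def by blast
        ultimately show ?thesis unfolding S1_def rejected_def by blast
      qed
      then show ?thesis using E(1) EB unfolding S2_def by blast
    qed
    \<comment> \<open>Density of \<open>S2\<close> was shown only below \<open>B1\<close>, so here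
      \<open>B1\<close> is the bound \<open>A0\<close> of the fusion.\<close>
    have "\<exists>B\<in>H. B \<sqsubseteq> B1 \<and> a0 \<in> AR_below B \<and> (\<forall>a\<in>AR_below B. extends a0 a \<longrightarrow> S2 a B)"
      by (rule settle_extensions[OF B1R _ _ B1(1) le_reflI[OF B1R] B1(3)])
        (erule (3) S2_mono, erule (2) S2_dense)
    then obtain B2 where B2: "B2 \<in> H" "B2 \<sqsubseteq> B1" "a0 \<in> AR_below B2"
      "\<And>a. a \<in> AR_below B2 \<Longrightarrow> extends a0 a \<Longrightarrow> S2 a B2"
      by blast
    have B2R: "B2 \<in> R" using B2 H_in_R by blast
    have rej: "rejected (r l C)" if C: "C \<in> nbhd a0 B2" and "len a0 \<le> l" for C l
      using that(2)
    proof (induction l rule: dec_induct)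
      case base
      then show ?case using C True by (simp add: nbhd_iff)
    next
      case (step l)
      have CR: "C \<in> R" "C \<sqsubseteq> B2" "r (len a0) C = a0" using C by (auto simp: nbhd_iff)
      have "extends a0 (r l C)" unfolding extends_def using CR step.hyps(1) by blast
      then have "S2 (r l C) B2" using B2(4) AR_below_r CR by blast
      moreover have "C \<in> nbhd (r l C) B2" using CR by (auto simp: nbhd_def)
      ultimately show ?case
        using step.IH \<open>extends a0 (r l C)\<close> len_r[OF CR(1), of l] unfolding S2_def by fastforce
    qed
    obtain b B' where b: "b \<in> AR" "B' \<in> H" "nbhd b B' \<noteq> {}" "nbhd b B' \<subseteq> nbhd a0 B2"
      "decided b B'"
      using Baire \<open>a0 \<in> AR\<close> B2(1,3) unfolding Baire_for_def AR_below_iff decided_def by metis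
    have B'R: "B' \<in> R" using b H_in_R by blast
    obtain C where C: "C \<in> nbhd b B'" using b(3) by blast
    then have C2: "C \<in> nbhd a0 B2" using b(4) by blast
    have CR: "C \<in> R" "r (len b) C = b" "r (len a0) C = a0" "C \<sqsubseteq> B'"
      using C C2 by (auto simp: nbhd_iff)
    \<comment> \<open>The \<open>b\<close> given by the Baire property may be shorter than
      \<open>a0\<close>, so it is prolonged along \<open>C\<close> to the larger of the two lengths.
      Then \<open>c\<close> is decided by \<open>D\<close> as an extension of \<open>b\<close>, and
      rejected as an initial segment of \<open>C\<close> of length at least that of
      \<open>a0\<close>.\<close>
    define c where "c = r (max (len a0) (len b)) C"
    have bc: "extends b c"
      unfolding c_def extends_def
      by (intro bexI[of _ C] exI[of _ "len b"] exI[of _ "max (len a0) (len b)"]) (simp_all add: CR)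
    have "c \<in> AR_below B'" unfolding c_def using AR_below_r CR by blast
    then obtain D where D: "D \<in> H" "D \<in> nbhd c B'" using coideal_meets b(2) by blast
    have DR: "D \<in> R" "D \<sqsubseteq> B'" using D(2) by (auto simp: nbhd_iff)
    have "D \<in> nbhd a0 B2" using D(2) extends_nbhd[OF bc] b(4) by blast
    then have "D \<sqsubseteq> B2" by (simp add: nbhd_iff)
    then have "D \<sqsubseteq> B1" using le_transD[OF _ B2(2) DR(1) B2R B1R] by blast
    then have "D \<in> nbhd c B1" using D(2) by (simp add: nbhd_iff)
    moreover have "decided c D"
      using b(5) extends_nbhd[OF bc, of D] nbhd_mono[OF DR(2) B'R DR(1), of b]
      unfolding decided_def by blast
    moreover have "rejected c" unfolding c_def using rej[OF C2] by simp
    ultimately show ?thesis using D(1) unfolding rejected_def by blast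
  qed
qed

end

theorem mainTheorem4:
  fixes R :: "'r set"
    and le :: "'r \<Rightarrow> 'r \<Rightarrow> bool"
    and r :: "nat \<Rightarrow> 'r \<Rightarrow> 'a"
    and emp :: 'a
    and lefin :: "'a \<Rightarrow> 'a \<Rightarrow> bool"
    and H X :: "'r set"
  assumes "topological_Ramsey_space R le r emp lefin"
    and "H \<subseteq> R"
    and "approx_structure.coideal R le r lefin H"
    and "approx_structure.selective R le r H"
    and "X \<subseteq> R"
  shows "approx_structure.Ramsey_for R le r H X \<longleftrightarrow> approx_structure.Baire_for R le r H X"
proof -
  interpret topological_Ramsey_space R le r emp lefin by fact
  interpret selective_coideal R le r emp lefin H by unfold_locales (fact assms)+
  show ?thesis using Ramsey_imp_Baire Baire_imp_Ramsey by blast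
qed

end
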